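(* For each positive integer $n$, let $f(n)$ be the maximum number of very typical vertices in a graph of order $n$, and let $g(n)$ be the maximum number of typical vertices in a graph of order $n$ (each maximum taken over all finite simple graphs with $n$ vertices). Then $$ f(n)=\begin{cases} 0 & \text{if } n\le 4;\\ n-4 & \text{if } 5\le n\le 6;\\ n-3 & \text{if } 7\le n\le 9;\\ n-2 & \text{if } n\ge 10 \end{cases} $$ and $$ g(n)=\begin{cases} 0 & \text{if } n\le 4;\\ n-3 & \text{if } 5\le n\le 8;\\ n-2 & \text{if } n\ge 9. \end{cases} $$
   Context: All graphs are finite and simple. The order of a graph is its number of vertices. For a vertex $v$, $d(v)$ denotes its degree and $N(v)$ its (open) neighborhood. A vertex $u$ is very typical if $d(u)\ge 2$, every $v\in N(u)$ satisfies $d(v)\ne d(u)$, at least one $x\in N(u)$ has $d(x)>d(u)$, and at least one $y\in N(u)$ has $d(y)<d(u)$. A vertex $u$ is typical if $d(u)\ge 3$ and there are three distinct vertices $x,y,z\in N(u)$ satisfying $d(x)<d(u)=d(y)<d(z)$. *)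

theory Defs
  imports "Graph_Theory.Pair_Digraph"
begin

text \<open>
  A finite simple graph is a \<^locale>\<open>pair_graph\<close>: finite vertex set, arcs given as a symmetric
  irreflexive set of pairs of vertices. Each undirected edge is represented by its two
  orientations, so the degree of a vertex counts its neighbours and not all incident arcs.
\<close>

definition nbhd :: "'a pair_pre_digraph \<Rightarrow> 'a \<Rightarrow> 'a set" where
  "nbhd G u = {v. (u, v) \<in> parcs G}"

definition deg :: "'a pair_pre_digraph \<Rightarrow> 'a \<Rightarrow> nat" where
  "deg G u = card (nbhd G u)"

definition very_typical :: "'a pair_pre_digraph \<Rightarrow> 'a \<Rightarrow> bool" where
  "very_typical G u \<longleftrightarrow>
     deg G u \<ge> 2 \<and>
     (\<forall>v\<in>nbhd G u. deg G v \<noteq> deg G u) \<and>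
     (\<exists>x\<in>nbhd G u. deg G x > deg G u) \<and>
     (\<exists>y\<in>nbhd G u. deg G y < deg G u)"

definition typical :: "'a pair_pre_digraph \<Rightarrow> 'a \<Rightarrow> bool" where
  "typical G u \<longleftrightarrow>
     deg G u \<ge> 3 \<and>
     (\<exists>x\<in>nbhd G u. \<exists>y\<in>nbhd G u. \<exists>z\<in>nbhd G u.
        distinct [x, y, z] \<and> deg G x < deg G u \<and> deg G u = deg G y \<and> deg G u < deg G z)"

text \<open>
  It suffices to let the graphs range over those whose vertices are natural numbers, since every
  finite graph is isomorphic to one of these; see \<open>card_very_typical_le_max\<close> and
  \<open>card_typical_le_max\<close> below for graphs over an arbitrary vertex type.
\<close>

definition max_very_typical :: "nat \<Rightarrow> nat" where
  "max_very_typical n =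
     Max {card {u \<in> pverts G. very_typical G u} | G :: nat pair_pre_digraph.
            pair_graph G \<and> card (pverts G) = n}"

definition max_typical :: "nat \<Rightarrow> nat" where
  "max_typical n =
     Max {card {u \<in> pverts G. typical G u} | G :: nat pair_pre_digraph.
            pair_graph G \<and> card (pverts G) = n}"

lemma pair_graph_iff:
  "pair_graph G \<longleftrightarrow>
     finite (pverts G) \<and> parcs G \<subseteq> pverts G \<times> pverts G \<and> sym (parcs G) \<and> irrefl (parcs G)"
proof
  assume "pair_graph G"
  then interpret pair_graph G .
  show "finite (pverts G) \<and> parcs G \<subseteq> pverts G \<times> pverts G \<and> sym (parcs G) \<and> irrefl (parcs G)"
    using pair_finite_verts arc_fst_in_verts arc_snd_in_verts pair_sym_arcs pair_no_loops
    by (fastforce simp: symmetric_def irrefl_def)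
next
  assume "finite (pverts G) \<and> parcs G \<subseteq> pverts G \<times> pverts G \<and> sym (parcs G) \<and> irrefl (parcs G)"
  then show "pair_graph G"
    by unfold_locales
      (auto simp: symmetric_def irrefl_def arcs_ends_def arc_to_ends_def
            intro: finite_subset[of "parcs G" "pverts G \<times> pverts G"])
qed

lemma max_candidates:
  fixes P :: "nat pair_pre_digraph \<Rightarrow> nat \<Rightarrow> bool" and n :: nat
  defines "S \<equiv> {card {u \<in> pverts G. P G u} | G. pair_graph G \<and> card (pverts G) = n}"
  shows "finite S" "S \<noteq> {}"
proof -
  have "card {u \<in> pverts G. P G u} \<le> n" if "pair_graph G" "card (pverts G) = n" for G
    using that by (auto simp: pair_graph_iff intro: card_mono)
  then have "S \<subseteq> {..n}" by (auto simp: S_def)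
  then show "finite S" by (rule finite_subset) simp
  have "pair_graph \<lparr>pverts = {..<n}, parcs = {}\<rparr>"
    by (simp add: pair_graph_iff sym_def irrefl_def)
  then have "card {u \<in> pverts \<lparr>pverts = {..<n}, parcs = {}\<rparr>.
      P \<lparr>pverts = {..<n}, parcs = {}\<rparr> u} \<in> S"
    unfolding S_def by (intro CollectI exI conjI) auto
  then show "S \<noteq> {}" by blast
qed

lemma ex_nat_copy:
  fixes G :: "'a pair_pre_digraph"
  assumes "pair_graph G"
  obtains h :: "'a \<Rightarrow> nat" and H :: "nat pair_pre_digraph" where
    "pair_graph H" "inj_on h (pverts G)" "pverts H = h ` pverts G"
    "\<And>u. u \<in> pverts G \<Longrightarrow> nbhd H (h u) = h ` nbhd G u"
    "\<And>u. u \<in> pverts G \<Longrightarrow> deg H (h u) = deg G u"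
proof -
  have fin: "finite (pverts G)" and sy: "sym (parcs G)" and irr: "irrefl (parcs G)"
    and mem: "\<And>a b. (a, b) \<in> parcs G \<Longrightarrow> a \<in> pverts G \<and> b \<in> pverts G"
    using assms unfolding pair_graph_iff by blast+
  obtain h :: "'a \<Rightarrow> nat" where h: "inj_on h (pverts G)"
    using finite_imp_inj_to_nat_seg[OF fin] by blast
  define H where "H = \<lparr>pverts = h ` pverts G, parcs = map_prod h h ` parcs G\<rparr>"
  have vH: "pverts H = h ` pverts G" by (simp add: H_def)
  have aH: "(x, y) \<in> parcs H \<longleftrightarrow> (\<exists>a b. (a, b) \<in> parcs G \<and> x = h a \<and> y = h b)" for x y
    unfolding H_def by auto
  have "sym (parcs H)"
    unfolding sym_def aH using symD[OF sy] by blast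
  moreover have "irrefl (parcs H)"
    unfolding irrefl_def aH using irr[unfolded irrefl_def] mem inj_onD[OF h] by metis
  moreover have "parcs H \<subseteq> pverts H \<times> pverts H"
    unfolding subset_iff split_paired_All aH vH mem_Sigma_iff using mem by blast
  ultimately have H: "pair_graph H"
    using fin by (simp add: pair_graph_iff vH)
  have nb: "nbhd H (h u) = h ` nbhd G u" if u: "u \<in> pverts G" for u
  proof (intro equalityI subsetI)
    fix w assume "w \<in> nbhd H (h u)"
    then obtain a b where ab: "(a, b) \<in> parcs G" "h u = h a" "w = h b"
      unfolding nbhd_def aH by blast
    then have "u = a" using mem inj_onD[OF h] u by blast
    with ab show "w \<in> h ` nbhd G u" by (simp add: nbhd_def)
  next
    fix w assume "w \<in> h ` nbhd G u"
    then show "w \<in> nbhd H (h u)" unfolding nbhd_def mem_Collect_eq aH by blast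
  qed
  have dg: "deg H (h u) = deg G u" if u: "u \<in> pverts G" for u
  proof -
    have "nbhd G u \<subseteq> pverts G" using mem by (auto simp: nbhd_def)
    then have "inj_on h (nbhd G u)" by (rule inj_on_subset[OF h])
    then show ?thesis by (simp add: deg_def nb[OF u] card_image)
  qed
  show thesis
    by (rule that[OF H h vH nb dg])
qed

lemma card_copy_le_Max:
  fixes G :: "'a pair_pre_digraph" and P :: "nat pair_pre_digraph \<Rightarrow> nat \<Rightarrow> bool"
  assumes "pair_graph H" "inj_on h (pverts G)" "pverts H = h ` pverts G"
    and PQ: "\<And>u. u \<in> pverts G \<Longrightarrow> P H (h u) \<longleftrightarrow> Q u"
  shows "card {u \<in> pverts G. Q u} \<le>
    Max {card {u \<in> pverts G'. P G' u} | G'. pair_graph G' \<and> card (pverts G') = card (pverts G)}"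
proof -
  have "{w \<in> pverts H. P H w} = h ` {u \<in> pverts G. Q u}"
    using assms(3) PQ by auto
  moreover have "inj_on h {u \<in> pverts G. Q u}"
    by (rule inj_on_subset[OF assms(2)]) auto
  ultimately have "card {w \<in> pverts H. P H w} = card {u \<in> pverts G. Q u}"
    by (simp add: card_image)
  moreover have "card (pverts H) = card (pverts G)"
    using assms(2,3) by (simp add: card_image)
  ultimately show ?thesis
    using assms(1) by (intro Max_ge max_candidates) (auto intro!: exI[of _ H])
qed

lemma card_very_typical_le_max:
  fixes G :: "'a pair_pre_digraph"
  assumes "pair_graph G"
  shows "card {u \<in> pverts G. very_typical G u} \<le> max_very_typical (card (pverts G))"
proof -
  have sub: "nbhd G u \<subseteq> pverts G" for u
    using assms by (auto simp: pair_graph_iff nbhd_def)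
  obtain h :: "'a \<Rightarrow> nat" and H where h: "pair_graph H" "inj_on h (pverts G)" "pverts H = h ` pverts G"
    "\<And>u. u \<in> pverts G \<Longrightarrow> nbhd H (h u) = h ` nbhd G u"
    "\<And>u. u \<in> pverts G \<Longrightarrow> deg H (h u) = deg G u"
    using ex_nat_copy[OF assms] by metis
  have "very_typical H (h u) \<longleftrightarrow> very_typical G u" if "u \<in> pverts G" for u
    using h(4,5) that sub[of u] by (auto simp: very_typical_def subset_iff)
  then show ?thesis
    unfolding max_very_typical_def by (rule card_copy_le_Max[OF h(1-3)])
qed

lemma card_typical_le_max:
  fixes G :: "'a pair_pre_digraph"
  assumes "pair_graph G"
  shows "card {u \<in> pverts G. typical G u} \<le> max_typical (card (pverts G))"
proof -
  have sub: "nbhd G u \<subseteq> pverts G" for u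
    using assms by (auto simp: pair_graph_iff nbhd_def)
  obtain h :: "'a \<Rightarrow> nat" and H where h: "pair_graph H" "inj_on h (pverts G)" "pverts H = h ` pverts G"
    "\<And>u. u \<in> pverts G \<Longrightarrow> nbhd H (h u) = h ` nbhd G u"
    "\<And>u. u \<in> pverts G \<Longrightarrow> deg H (h u) = deg G u"
    using ex_nat_copy[OF assms] by metis
  have "typical H (h u) \<longleftrightarrow> typical G u" if u: "u \<in> pverts G" for u
  proof -
    have eq: "deg H (h x) = deg G x" "h x = h y \<longleftrightarrow> x = y"
      if "x \<in> nbhd G u" "y \<in> nbhd G u" for x y
      using h(2,5) sub that by (auto dest: inj_onD)
    show ?thesis
      unfolding typical_def h(4)[OF u] h(5)[OF u] bex_simps(7)
      by (intro conj_cong refl bex_cong) (simp_all add: eq)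
  qed
  then show ?thesis
    unfolding max_typical_def by (rule card_copy_le_Max[OF h(1-3)])
qed

end

theory Submission
  imports Defs
begin

text \<open>
  A vertex of minimum or maximum degree is neither typical nor very typical, so both maxima are at
  most \<open>n - 2\<close>. For small \<open>n\<close> this is improved by cutting the graph at a degree \<open>t\<close>: every typical
  vertex of degree less than \<open>t\<close> sends an edge to a vertex of smaller degree (and shares one with a
  vertex of equal degree), so there are many edges inside the low part; very typical vertices of
  equal degree are never adjacent, so there are few edges inside the high part. As the edges across
  the cut are counted by both degree sums, this bounds the degree sum of the high part in terms of
  that of the low part, for every \<open>t\<close>. No degree distribution of small total size meets all these
  bounds, which is a finite search.

  For the lower bounds, adding a universal vertex shifts all degrees by one. For very typical
  vertices this is repeated forever by alternating it with hanging a leaf on the vertex of minimum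
  degree; for typical vertices by joining the new vertex to all but the vertex of minimum degree.
  The sporadic graphs were found by computer.
\<close>

section \<open>Feasible degree distributions\<close>

text \<open>Lower bound for the number of arcs within one degree class when each of its
  \<open>p\<close> marked vertices needs a neighbour of the same degree. These arcs come in opposite
  pairs, hence the rounding up to an even number.\<close>

definition equal_excess :: "bool \<Rightarrow> int \<Rightarrow> int" where
  "equal_excess same p = (if same then p + p mod 2 else 0)"

text \<open>Number of ordered pairs of distinct vertices in a degree class that involve at least one
  of the \<open>p\<close> marked ones. For very typical marks none of these pairs is an arc.\<close>

definition equal_deficit :: "bool \<Rightarrow> int \<Rightarrow> int \<Rightarrow> int" where
  "equal_deficit same p q = (if same then 0 else (p + q) * (p + q - 1) - q * (q - 1))"

text \<open>
  The search runs through the degrees \<open>j\<close> upwards and chooses the numbers \<open>p\<close> of marked (typical) and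
  \<open>q\<close> of unmarked vertices of degree \<open>j\<close>; \<open>P\<close> and \<open>Q\<close> vertices remain. Here \<open>cap\<close> bounds the number of
  edges from the vertices chosen so far to the remaining ones, and \<open>S\<close> sums the degrees
  of the chosen vertices plus, for very typical marks, the non-adjacent ordered pairs of equal degree. The cut inequality at \<open>j\<close> bounds the
  final value of \<open>S\<close> by a quantity known at stage \<open>j\<close>; \<open>B\<close> is the minimum of these bounds.
\<close>

fun feasible :: "bool \<Rightarrow> nat \<Rightarrow> int \<Rightarrow> int \<Rightarrow> int \<Rightarrow> int \<Rightarrow> int \<Rightarrow> int \<Rightarrow> bool" where
  "feasible same 0 j P Q cap S B \<longleftrightarrow> P + Q = 0 \<and> S \<le> B"
| "feasible same (Suc k) j P Q cap S B \<longleftrightarrow>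
     (if P + Q = 0 then S \<le> B
      else let B' = min B ((P + Q) * (P + Q - 1) + cap + S) in
        if S + j * (P + Q) \<le> B' then
          list_ex (\<lambda>p. list_ex (\<lambda>q.
            if p = 0 \<or> p + q < P + Q then
              feasible same k (j + 1) (P - p) (Q - q)
                (cap + j * (p + q) - 2 * p - equal_excess same p)
                (S + j * (p + q) + equal_deficit same p q) B'
            else False) [0..Q]) [0..min P cap]
        else False)"

lemma equal_deficit_nonneg:
  assumes "0 \<le> p" "0 \<le> q"
  shows "0 \<le> equal_deficit same p q"
proof -
  have "(p + q) * (p + q - 1) - q * (q - 1) = p * (p - 1) + 2 * (p * q)"
    by (simp add: algebra_simps)
  moreover have "0 \<le> p * (p - 1)"
    using assms(1) by (cases "p = 0") auto
  ultimately show ?thesis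
    using assms by (simp add: equal_deficit_def)
qed

text \<open>On the branch that picks the true \<open>p j\<close> and \<open>q j\<close> at every
  degree, the arguments of \<open>feasible\<close> are the partial sums \<open>P j\<close>,
  \<open>Q j\<close>, \<open>cap j\<close> and \<open>S j\<close>, and the cut inequalities preserve
  \<open>S n \<le> B\<close>; so no test on this branch fails. Acceptance need not come from a
  graph: only a refusal is informative.\<close>

lemma feasible_complete:
  fixes p q :: "nat \<Rightarrow> int" and n :: nat and same :: bool
  defines "cap \<equiv> \<lambda>t. \<Sum>i<t. int i * (p i + q i) - 2 * p i - equal_excess same (p i)"
    and "S \<equiv> \<lambda>t. \<Sum>i<t. int i * (p i + q i) + equal_deficit same (p i) (q i)"
    and "P \<equiv> \<lambda>t. \<Sum>i=t..<n. p i" and "Q \<equiv> \<lambda>t. \<Sum>i=t..<n. q i"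
  assumes nonneg: "\<And>i. 0 \<le> p i" "\<And>i. 0 \<le> q i"
    and lower: "\<And>t. t < n \<Longrightarrow> p t \<le> cap t"
    and cut: "\<And>t. t < n \<Longrightarrow> S n \<le> (P t + Q t) * (P t + Q t - 1) + cap t + S t"
    and top: "\<And>t. t < n \<Longrightarrow> p t = 0 \<or> p t + q t < P t + Q t"
  shows "j \<le> n \<Longrightarrow> S n \<le> B \<Longrightarrow> feasible same (n - j) (int j) (P j) (Q j) (cap j) (S j) B"
proof (induction "n - j" arbitrary: j B)
  case 0
  then have "j = n" by simp
  with 0 show ?case by (simp add: P_def Q_def)
next
  case (Suc k)
  then have j: "j < n" by simp
  have PQ: "P j = p j + P (Suc j)" "Q j = q j + Q (Suc j)"
    using j by (auto simp: P_def Q_def sum.atLeast_Suc_lessThan)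
  have PQ0: "0 \<le> P i" "0 \<le> Q i" for i
    using nonneg by (auto simp: P_def Q_def intro: sum_nonneg)
  have S_split: "S n = S j + (\<Sum>i=j..<n. int i * (p i + q i) + equal_deficit same (p i) (q i))"
  proof -
    show ?thesis unfolding S_def lessThan_atLeast0
      using j by (simp add: sum.atLeastLessThan_concat)
  qed
  \<comment> \<open>All remaining vertices have degree at least \<open>j\<close> and deficits are
    nonnegative, so the quantity in the pruning test never exceeds the final
    \<open>S n\<close>.\<close>
  have "int j * (P j + Q j) = (\<Sum>i=j..<n. int j * (p i + q i))"
    by (simp add: P_def Q_def sum.distrib[symmetric] sum_distrib_left)
  also have "\<dots> \<le> (\<Sum>i=j..<n. int i * (p i + q i) + equal_deficit same (p i) (q i))"
  proof (rule sum_mono)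
    fix i assume "i \<in> {j..<n}"
    then have "int j * (p i + q i) \<le> int i * (p i + q i)"
      using nonneg[of i] by (intro mult_right_mono) auto
    then show "int j * (p i + q i) \<le> int i * (p i + q i) + equal_deficit same (p i) (q i)"
      using equal_deficit_nonneg[OF nonneg(1,2)[of i], of same] by linarith
  qed
  finally have S_ge: "S j + int j * (P j + Q j) \<le> S n"
    using S_split by linarith
  define B' where "B' = min B ((P j + Q j) * (P j + Q j - 1) + cap j + S j)"
  have B': "S n \<le> B'"
    using cut[OF j] Suc.prems by (simp add: B'_def)
  have IH: "feasible same k (int j + 1) (P j - p j) (Q j - q j)
      (cap j + int j * (p j + q j) - 2 * p j - equal_excess same (p j))
      (S j + int j * (p j + q j) + equal_deficit same (p j) (q j)) B'"
  proof -
    have "k = n - Suc j" using Suc.hyps(2) by simp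
    from Suc.hyps(1)[OF this _ B'] j
    have "feasible same k (int (Suc j)) (P (Suc j)) (Q (Suc j)) (cap (Suc j)) (S (Suc j)) B'"
      using \<open>k = n - Suc j\<close> by simp
    moreover have "cap (Suc j) = cap j + int j * (p j + q j) - 2 * p j - equal_excess same (p j)"
      "S (Suc j) = S j + int j * (p j + q j) + equal_deficit same (p j) (q j)"
      by (simp_all add: cap_def S_def)
    ultimately show ?thesis using PQ by (simp add: add.commute)
  qed
  have mem: "p j \<in> set [0..min (P j) (cap j)]" "q j \<in> set [0..Q j]"
    using nonneg[of j] lower[OF j] PQ PQ0[of "Suc j"] by auto
  have "feasible same (Suc k) (int j) (P j) (Q j) (cap j) (S j) B"
  proof (cases "P j + Q j = 0")
    case True
    then show ?thesis using S_ge Suc.prems by simp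
  next
    case False
    show ?thesis
      unfolding feasible.simps Let_def B'_def[symmetric] list_ex_iff
        if_not_P[OF False] if_P[OF order_trans[OF S_ge B']]
      using IH top[OF j] by (intro bexI[OF _ mem(1)] bexI[OF _ mem(2)]) simp
  qed
  then show ?case using Suc.hyps(2) by simp
qed


section \<open>Cutting a graph at a degree\<close>

text \<open>The pairs with \<open>u < v\<close> form one half of \<open>R\<close>, and their
  converses form the other half.\<close>

lemma even_card_sym:
  fixes R :: "(nat \<times> nat) set"
  assumes "finite R" "sym R" "irrefl R"
  shows "even (card R)"
proof -
  define U where "U = {(u, v) \<in> R. u < v}"
  have "R = U \<union> U\<inverse>"
    unfolding U_def using assms(2,3) by (auto simp: irrefl_def dest: symD)
  moreover have "U \<inter> U\<inverse> = {}" by (auto simp: U_def)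
  moreover have fin: "finite U" by (rule finite_subset[OF _ assms(1)]) (auto simp: U_def)
  ultimately have "card R = card U + card (U\<inverse>)"
    using card_Un_disjoint[of U "U\<inverse>"] by simp
  then show ?thesis by (simp add: card_inverse)
qed

lemma add_mod_2_le:
  fixes a s :: int
  assumes "a \<le> s" "even s"
  shows "a + a mod 2 \<le> s"
  using assms by presburger

lemma card_offdiag:
  assumes "finite C"
  shows "int (card (C \<times> C - Id)) = int (card C) * (int (card C) - 1)"
proof -
  have "C \<times> C - Id = C \<times> C - (\<lambda>x. (x, x)) ` C" by auto
  moreover have "card ((\<lambda>x. (x, x)) ` C) = card C" by (rule card_image) (auto simp: inj_on_def)
  ultimately have "card (C \<times> C - Id) = card C * card C - card C"
    using assms by (simp add: card_Diff_subset card_cartesian_product image_subset_iff)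
  then show ?thesis
    by (simp add: algebra_simps of_nat_diff)
qed

text \<open>Treats both notions at once: \<open>same\<close> is true for typical and false for very
  typical vertices. \<open>A\<close> may be any subset of these vertices, so its size can be
  prescribed; those left out of \<open>A\<close> count as unmarked.\<close>

locale typical_set =
  fixes G :: "nat pair_pre_digraph" and A :: "nat set" and same :: bool
  assumes graph: "pair_graph G" and sub: "A \<subseteq> pverts G"
    and lower: "\<And>v. v \<in> A \<Longrightarrow> \<exists>w\<in>nbhd G v. deg G w < deg G v"
    and higher: "\<And>v. v \<in> A \<Longrightarrow> \<exists>w\<in>nbhd G v. deg G v < deg G w"
    and equal: "\<And>v. v \<in> A \<Longrightarrow> same \<Longrightarrow> \<exists>w\<in>nbhd G v. deg G w = deg G v"
    and unequal: "\<And>v w. v \<in> A \<Longrightarrow> \<not> same \<Longrightarrow> w \<in> nbhd G v \<Longrightarrow> deg G w \<noteq> deg G v"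
begin

abbreviation "V \<equiv> pverts G"
abbreviation "E \<equiv> parcs G"
abbreviation "d \<equiv> deg G"
abbreviation "n \<equiv> card V"

definition p :: "nat \<Rightarrow> int" where "p j = int (card {v \<in> A. d v = j})"
definition q :: "nat \<Rightarrow> int" where "q j = int (card {v \<in> V - A. d v = j})"

lemma graph_facts:
  shows finV: "finite V" and E_sub: "E \<subseteq> V \<times> V" and symE: "sym E" and irrE: "irrefl E"
    and finE: "finite E" and finA: "finite A"
  using graph sub by (auto simp: pair_graph_iff intro: finite_subset[of _ "V \<times> V"] finite_subset)

lemma converse_mem_E: "(u, v) \<in> E \<longleftrightarrow> (v, u) \<in> E"
  using symE by (auto dest: symD)

lemma deg_less:
  assumes "v \<in> V"
  shows "d v < n"
proof -
  have "nbhd G v \<subseteq> V - {v}"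
    using E_sub irrE by (auto simp: nbhd_def irrefl_def)
  then have "d v \<le> card (V - {v})"
    using finV unfolding deg_def by (intro card_mono) auto
  also have "\<dots> < n" using finV assms by (rule card_Diff1_less)
  finally show ?thesis .
qed

lemma card_class: "int (card {v \<in> V. d v = j}) = p j + q j"
proof -
  have "{v \<in> V. d v = j} = {v \<in> A. d v = j} \<union> {v \<in> V - A. d v = j}"
    using sub by auto
  then have "card {v \<in> V. d v = j} = card {v \<in> A. d v = j} + card {v \<in> V - A. d v = j}"
    using finA finV by (simp add: card_Un_disjoint disjoint_iff)
  then show ?thesis by (simp add: p_def q_def)
qed

lemma sum_by_degree:
  fixes f :: "nat \<Rightarrow> int"
  assumes "U \<subseteq> V"
  shows "(\<Sum>v\<in>{v \<in> U. d v \<in> J}. f (d v)) = (\<Sum>j\<in>J \<inter> {..<n}. int (card {v \<in> U. d v = j}) * f j)"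
proof -
  have fin: "finite {v \<in> U. d v \<in> J}"
    using assms finV by (auto intro: finite_subset)
  have sub': "d ` {v \<in> U. d v \<in> J} \<subseteq> J \<inter> {..<n}"
    using assms deg_less by auto
  have "(\<Sum>v\<in>{v \<in> U. d v \<in> J}. f (d v)) =
      (\<Sum>j\<in>J \<inter> {..<n}. \<Sum>v\<in>{v \<in> {v \<in> U. d v \<in> J}. d v = j}. f (d v))"
    by (rule sum.group[OF fin _ sub', symmetric]) simp
  also have "\<dots> = (\<Sum>j\<in>J \<inter> {..<n}. int (card {v \<in> U. d v = j}) * f j)"
  proof (rule sum.cong[OF refl])
    fix j assume "j \<in> J \<inter> {..<n}"
    then have "{v \<in> {v \<in> U. d v \<in> J}. d v = j} = {v \<in> U. d v = j}" by auto
    then show "(\<Sum>v\<in>{v \<in> {v \<in> U. d v \<in> J}. d v = j}. f (d v)) = int (card {v \<in> U. d v = j}) * f j"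
      by simp
  qed
  finally show ?thesis .
qed

lemma card_arcs_from:
  assumes "U \<subseteq> V"
  shows "int (card (E \<inter> U \<times> V)) = (\<Sum>v\<in>U. int (d v))"
proof -
  have "E \<inter> U \<times> V = Sigma U (nbhd G)"
    using E_sub by (auto simp: nbhd_def)
  moreover have "finite U" using assms finV by (rule finite_subset)
  moreover have "\<forall>v\<in>U. finite (nbhd G v)"
    using E_sub finV by (auto simp: nbhd_def intro: finite_subset[of _ V])
  ultimately show ?thesis by (simp add: deg_def card_SigmaI)
qed

section \<open>Arcs inside and across the two sides of a degree cut\<close>

abbreviation "L t \<equiv> {v \<in> V. d v < t}"
abbreviation "T t \<equiv> {v \<in> V. t \<le> d v}"

text \<open>Sorting arcs by the larger end degree gives disjoint classes, and both the downward and
  the level arcs of a marked vertex of degree \<open>j\<close> fall into class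
  \<open>j\<close>.\<close>

definition X :: "nat \<Rightarrow> (nat \<times> nat) set" where "X j = {(u, v) \<in> E. max (d u) (d v) = j}"

text \<open>Each marked vertex of degree \<open>j\<close> is the source of a downward arc, which
  counts twice because its converse also lies in \<open>X j\<close>. If \<open>same\<close> holds,
  it is also the source of a level arc, and the number of level arcs is even.\<close>

lemma card_X_ge: "2 * p j + equal_excess same (p j) \<le> int (card (X j))"
proof -
  let ?D = "{(u, v) \<in> E. d u = j \<and> d v < j}"
  let ?S = "{(u, v) \<in> E. d u = j \<and> d v = j}"
  have fin: "finite ?D" "finite ?S"
    by (auto intro: finite_subset[OF _ finE])
  have "{v \<in> A. d v = j} \<subseteq> fst ` ?D"
    using lower by (force simp: nbhd_def image_iff)
  then have "card {v \<in> A. d v = j} \<le> card ?D"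
    using surj_card_le[OF fin(1)] by blast
  then have D: "p j \<le> int (card ?D)" by (simp add: p_def)
  have S: "equal_excess same (p j) \<le> int (card ?S)"
  proof (cases same)
    case True
    then have "{v \<in> A. d v = j} \<subseteq> fst ` ?S"
      using equal by (force simp: nbhd_def image_iff)
    then have "card {v \<in> A. d v = j} \<le> card ?S"
      using surj_card_le[OF fin(2)] by blast
    then have le: "p j \<le> int (card ?S)" by (simp add: p_def)
    have "even (card ?S)"
      using fin(2) symE irrE by (intro even_card_sym) (auto simp: sym_def irrefl_def)
    then have "even (int (card ?S))" by simp
    with le have "p j + p j mod 2 \<le> int (card ?S)" by (rule add_mod_2_le)
    with True show ?thesis unfolding equal_excess_def by (simp only: if_True)
  qed (simp add: equal_excess_def)
  have "X j = (?D \<union> ?D\<inverse>) \<union> ?S"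
    using converse_mem_E by (auto simp: X_def max_def)
  moreover have "(?D \<union> ?D\<inverse>) \<inter> ?S = {}" "?D \<inter> ?D\<inverse> = {}" by auto
  ultimately have "card (X j) = card ?D + card (?D\<inverse>) + card ?S"
    using fin by (simp add: card_Un_disjoint del: converse_unfold)
  then have "card (X j) = 2 * card ?D + card ?S"
    by (simp add: card_inverse)
  with D S show ?thesis by simp
qed

lemma card_arcs_low_ge:
  "(\<Sum>j<t. 2 * p j + equal_excess same (p j)) \<le> int (card (E \<inter> L t \<times> L t))"
proof -
  have "E \<inter> L t \<times> L t = (\<Union>j\<in>{..<t}. X j)"
    using E_sub by (auto simp: X_def)
  moreover have "finite (X j)" for j
    by (auto simp: X_def intro: finite_subset[OF _ finE])
  moreover have "\<forall>i\<in>{..<t}. \<forall>j\<in>{..<t}. i \<noteq> j \<longrightarrow> X i \<inter> X j = {}"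
    by (auto simp: X_def)
  ultimately have "card (E \<inter> L t \<times> L t) = (\<Sum>j<t. card (X j))"
    by (simp add: card_UN_disjoint)
  then have "int (card (E \<inter> L t \<times> L t)) = (\<Sum>j<t. int (card (X j)))" by simp
  also have "\<dots> \<ge> (\<Sum>j<t. 2 * p j + equal_excess same (p j))"
    by (intro sum_mono card_X_ge)
  finally show ?thesis .
qed

text \<open>When \<open>same\<close> is false, \<open>K j\<close> collects the ordered pairs of
  distinct vertices of degree \<open>j\<close> that are not both unmarked. By \<open>unequal\<close>
  these are not arcs, so the arcs inside \<open>T t\<close> and all \<open>K j\<close> with
  \<open>j \<ge> t\<close> share the off-diagonal pairs of \<open>T t\<close> disjointly.\<close>

lemma card_arcs_high_le:
  "int (card (E \<inter> T t \<times> T t)) + (\<Sum>j=t..<n. equal_deficit same (p j) (q j))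
     \<le> int (card (T t)) * (int (card (T t)) - 1)"
proof -
  define K where "K j = (if same then {} else
    ({v \<in> V. d v = j} \<times> {v \<in> V. d v = j} - Id) - ({v \<in> V - A. d v = j} \<times> {v \<in> V - A. d v = j} - Id))" for j
  have fin: "finite (K j)" for j
    using finV by (simp add: K_def)
  have card_K: "int (card (K j)) = equal_deficit same (p j) (q j)" for j
  proof (cases same)
    case False
    let ?C = "{v \<in> V. d v = j}" and ?B = "{v \<in> V - A. d v = j}"
    have "int (card (K j)) = int (card (?C \<times> ?C - Id)) - int (card (?B \<times> ?B - Id))"
    proof -
      have sub: "?B \<times> ?B - Id \<subseteq> ?C \<times> ?C - Id" by auto
      have fin: "finite (?C \<times> ?C - Id)" using finV by simp
      have "card (K j) = card (?C \<times> ?C - Id) - card (?B \<times> ?B - Id)"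
        unfolding K_def using False by (simp only: if_False card_Diff_subset[OF finite_subset[OF sub fin] sub])
      then show ?thesis using card_mono[OF fin sub] by (simp only: of_nat_diff)
    qed
    also have "\<dots> = int (card ?C) * (int (card ?C) - 1) - int (card ?B) * (int (card ?B) - 1)"
      using finV by (simp add: card_offdiag)
    also have "\<dots> = equal_deficit same (p j) (q j)"
      using False unfolding card_class equal_deficit_def by (simp add: q_def)
    finally show ?thesis .
  qed (simp add: K_def equal_deficit_def)
  have "card (\<Union>j\<in>{t..<n}. K j) = (\<Sum>j=t..<n. card (K j))"
    using fin by (intro card_UN_disjoint) (auto simp: K_def)
  then have sumK: "int (card (\<Union>j\<in>{t..<n}. K j)) = (\<Sum>j=t..<n. equal_deficit same (p j) (q j))"
    by (simp add: card_K)
  have disj: "(E \<inter> T t \<times> T t) \<inter> (\<Union>j\<in>{t..<n}. K j) = {}"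
  proof -
    have "(u, v) \<notin> K j" if "(u, v) \<in> E" for u v j
      using unequal[of u v] unequal[of v u] that converse_mem_E[of u v]
      by (auto simp: K_def nbhd_def)
    then show ?thesis by auto
  qed
  have "(E \<inter> T t \<times> T t) \<union> (\<Union>j\<in>{t..<n}. K j) \<subseteq> T t \<times> T t - Id"
    using irrE by (auto simp: K_def irrefl_def split: if_splits)
  then have "card ((E \<inter> T t \<times> T t) \<union> (\<Union>j\<in>{t..<n}. K j)) \<le> card (T t \<times> T t - Id)"
    using finV by (intro card_mono) auto
  then have "card (E \<inter> T t \<times> T t) + card (\<Union>j\<in>{t..<n}. K j) \<le> card (T t \<times> T t - Id)"
    using fin finE disj by (subst (asm) card_Un_disjoint) auto
  then have "int (card (E \<inter> T t \<times> T t)) + int (card (\<Union>j\<in>{t..<n}. K j)) \<le> int (card (T t \<times> T t - Id))"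
    by linarith
  then show ?thesis
    using finV by (simp add: sumK card_offdiag)
qed

text \<open>Arcs from low to high are the converses of arcs from high to low, so one crossing count
  occurs in both degree sums and can be eliminated between them.\<close>

lemma arcs_split:
  shows "(\<Sum>v\<in>L t. int (d v)) = int (card (E \<inter> L t \<times> L t)) + int (card (E \<inter> T t \<times> L t))"
    and "(\<Sum>v\<in>T t. int (d v)) = int (card (E \<inter> T t \<times> T t)) + int (card (E \<inter> T t \<times> L t))"
proof -
  have split: "int (card (E \<inter> U \<times> V)) = int (card (E \<inter> U \<times> L t)) + int (card (E \<inter> U \<times> T t))" for U
  proof -
    have "E \<inter> U \<times> V = (E \<inter> U \<times> L t) \<union> (E \<inter> U \<times> T t)" by auto
    moreover have "(E \<inter> U \<times> L t) \<inter> (E \<inter> U \<times> T t) = {}" by auto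
    ultimately show ?thesis using finE by (simp add: card_Un_disjoint)
  qed
  have "E \<inter> L t \<times> T t = (E \<inter> T t \<times> L t)\<inverse>"
    using converse_mem_E by auto
  then have "card (E \<inter> L t \<times> T t) = card (E \<inter> T t \<times> L t)"
    by (simp add: card_inverse del: converse_Int)
  then show "(\<Sum>v\<in>L t. int (d v)) = int (card (E \<inter> L t \<times> L t)) + int (card (E \<inter> T t \<times> L t))"
    using split[of "L t"] card_arcs_from[of "L t"] by auto
  show "(\<Sum>v\<in>T t. int (d v)) = int (card (E \<inter> T t \<times> T t)) + int (card (E \<inter> T t \<times> L t))"
    using split[of "T t"] card_arcs_from[of "T t"] by auto
qed

lemma card_crossing_ge: "p t \<le> int (card (E \<inter> T t \<times> L t))"
proof -
  have "{v \<in> A. d v = t} \<subseteq> fst ` (E \<inter> T t \<times> L t)"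
  proof
    fix v assume v: "v \<in> {v \<in> A. d v = t}"
    then obtain w where "(v, w) \<in> E" "d w < d v" using lower by (auto simp: nbhd_def)
    then have "(v, w) \<in> E \<inter> T t \<times> L t" using v E_sub by auto
    then show "v \<in> fst ` (E \<inter> T t \<times> L t)" by force
  qed
  then have "card {v \<in> A. d v = t} \<le> card (E \<inter> T t \<times> L t)"
    using surj_card_le[of "E \<inter> T t \<times> L t"] finE by blast
  then show ?thesis by (simp add: p_def)
qed

lemma feasible_degrees:
  "feasible same n 0 (int (card A)) (int (n - card A)) 0 0 (int n * (int n - 1))"
proof -
  let ?cap = "\<lambda>t. \<Sum>i<t. int i * (p i + q i) - 2 * p i - equal_excess same (p i)"
  let ?S = "\<lambda>t. \<Sum>i<t. int i * (p i + q i) + equal_deficit same (p i) (q i)"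
  let ?P = "\<lambda>t. \<Sum>i=t..<n. p i" and ?Q = "\<lambda>t. \<Sum>i=t..<n. q i"
  have low: "(\<Sum>v\<in>L t. int (d v)) = (\<Sum>i<t. int i * (p i + q i))" if "t \<le> n" for t
  proof -
    have "{..<t} \<inter> {..<n} = {..<t}" using that by auto
    then show ?thesis
      using sum_by_degree[of V int "{..<t}"] by (simp add: card_class mult.commute)
  qed
  have high: "(\<Sum>v\<in>T t. int (d v)) = (\<Sum>i=t..<n. int i * (p i + q i))" for t
  proof -
    have "{t..} \<inter> {..<n} = {t..<n}" by auto
    then show ?thesis
      using sum_by_degree[of V int "{t..}"] by (simp add: card_class mult.commute)
  qed
  have cardT: "int (card (T t)) = ?P t + ?Q t" for t
  proof -
    have "{t..} \<inter> {..<n} = {t..<n}" by auto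
    then show ?thesis
      using sum_by_degree[of V "\<lambda>_. 1" "{t..}"] by (simp add: card_class sum.distrib)
  qed
  have cap: "?cap t = (\<Sum>i<t. int i * (p i + q i)) - (\<Sum>i<t. 2 * p i + equal_excess same (p i))" for t
    by (simp add: sum_subtractf[symmetric] algebra_simps)
  \<comment> \<open>The crossing arcs number the low degree sum minus the arcs inside the low part,
    hence at most \<open>cap t\<close>; marked vertices of degree \<open>t\<close> supply at least
    \<open>p t\<close> of them.\<close>
  have cap_ge: "p t \<le> ?cap t" if "t < n" for t
    using arcs_split(1)[of t] low[of t] card_arcs_low_ge[of t] card_crossing_ge[of t] that
    unfolding cap by simp
  \<comment> \<open>Beyond \<open>S t\<close>, the sum \<open>S n\<close> consists of the degree sum
    and the deficits of the high part. The degree sum is inner arcs plus crossing arcs: inner arcs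
    and deficits together are bounded by the pairs in \<open>T t\<close>, crossing arcs by
    \<open>cap t\<close>.\<close>
  have cut: "?S n \<le> (?P t + ?Q t) * (?P t + ?Q t - 1) + ?cap t + ?S t" if "t < n" for t
  proof -
    have "?S n = ?S t + (\<Sum>i=t..<n. int i * (p i + q i) + equal_deficit same (p i) (q i))"
      using that unfolding lessThan_atLeast0 by (simp add: sum.atLeastLessThan_concat)
    then have "?S n = ?S t + (\<Sum>v\<in>T t. int (d v)) + (\<Sum>i=t..<n. equal_deficit same (p i) (q i))"
      by (simp add: high sum.distrib)
    then show ?thesis
      using arcs_split[of t] low[of t] card_arcs_low_ge[of t] card_arcs_high_le[of t] that
      unfolding cap cardT by simp
  qed
  \<comment> \<open>A marked vertex of degree \<open>t\<close> has a neighbour of larger degree, so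
    its degree class is not all of \<open>T t\<close>.\<close>
  have top: "p t = 0 \<or> p t + q t < ?P t + ?Q t" if "t < n" for t
  proof (cases "p t = 0")
    case False
    then obtain v where v: "v \<in> A" "d v = t" by (auto simp: p_def card_eq_0_iff)
    then obtain w where w: "(v, w) \<in> E" "t < d w" using higher by (auto simp: nbhd_def)
    then have "w \<in> T t" "w \<notin> {v \<in> V. d v = t}" using E_sub by auto
    then have "{v \<in> V. d v = t} \<subset> T t" by auto
    then have "card {v \<in> V. d v = t} < card (T t)" using finV by (intro psubset_card_mono) auto
    then show ?thesis using card_class[of t] cardT[of t] by linarith
  qed simp
  \<comment> \<open>The initial bound is the cut inequality at 0, which is available only for a
    nonempty graph.\<close>
  have S0: "?S n \<le> int n * (int n - 1)"
  proof (cases "n = 0")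
    case False
    then show ?thesis using cut[of 0] cardT[of 0] by simp
  qed simp
  have P0: "?P 0 = int (card A)"
    using sum_by_degree[OF sub, of "\<lambda>_. 1" UNIV] by (simp add: p_def atLeast0LessThan)
  have "?Q 0 = int (card (V - A))"
    using sum_by_degree[of "V - A" "\<lambda>_. 1" UNIV] by (simp add: q_def atLeast0LessThan set_diff_eq)
  then have Q0: "?Q 0 = int (n - card A)"
    using sub finA by (simp add: card_Diff_subset)
  have nonneg: "0 \<le> p i" "0 \<le> q i" for i by (simp_all add: p_def q_def)
  have "feasible same (n - 0) (int 0) (?P 0) (?Q 0) (?cap 0) (?S 0) (int n * (int n - 1))"
    by (rule feasible_complete[where p = p and q = q and n = n and same = same])
      (use nonneg cap_ge cut top S0 in blast)+
  then show ?thesis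
    unfolding P0 Q0 by (simp only: diff_zero of_nat_0 lessThan_0 sum.empty)
qed

end

section \<open>Graphs given by adjacency lists\<close>

text \<open>An executable encoding: once \<open>adj_ok\<close> has been evaluated, the lists
  describe a simple graph in which the length of a list is the degree.\<close>

definition adj_graph :: "nat list list \<Rightarrow> nat pair_pre_digraph" where
  "adj_graph xss = \<lparr>pverts = {..<length xss}, parcs = {(u, v). u < length xss \<and> v \<in> set (xss ! u)}\<rparr>"

definition adj_ok :: "nat list list \<Rightarrow> bool" where
  "adj_ok xss \<longleftrightarrow> list_all (\<lambda>u. distinct (xss ! u) \<and>
     list_all (\<lambda>v. v < length xss \<and> v \<noteq> u \<and> u \<in> set (xss ! v)) (xss ! u)) [0..<length xss]"

definition adj_deg :: "nat list list \<Rightarrow> nat \<Rightarrow> nat" where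
  "adj_deg xss u = length (xss ! u)"

definition adj_very_typical :: "nat list list \<Rightarrow> nat list" where
  "adj_very_typical xss = filter (\<lambda>u. 2 \<le> adj_deg xss u \<and>
     list_all (\<lambda>v. adj_deg xss v \<noteq> adj_deg xss u) (xss ! u) \<and>
     list_ex (\<lambda>v. adj_deg xss u < adj_deg xss v) (xss ! u) \<and>
     list_ex (\<lambda>v. adj_deg xss v < adj_deg xss u) (xss ! u)) [0..<length xss]"

definition adj_typical :: "nat list list \<Rightarrow> nat list" where
  "adj_typical xss = filter (\<lambda>u. 3 \<le> adj_deg xss u \<and>
     list_ex (\<lambda>v. adj_deg xss v < adj_deg xss u) (xss ! u) \<and>
     list_ex (\<lambda>v. adj_deg xss v = adj_deg xss u) (xss ! u) \<and>
     list_ex (\<lambda>v. adj_deg xss u < adj_deg xss v) (xss ! u)) [0..<length xss]"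

text \<open>The three neighbours compare differently with the degree of \<open>u\<close>, so they
  are automatically distinct and the conditions on them separate.\<close>

lemma typical_iff:
  "typical G u \<longleftrightarrow> 3 \<le> deg G u \<and> (\<exists>x\<in>nbhd G u. deg G x < deg G u) \<and>
     (\<exists>y\<in>nbhd G u. deg G y = deg G u) \<and> (\<exists>z\<in>nbhd G u. deg G u < deg G z)"
proof -
  have "distinct [x, y, z] \<and> deg G x < deg G u \<and> deg G u = deg G y \<and> deg G u < deg G z \<longleftrightarrow>
      deg G x < deg G u \<and> deg G y = deg G u \<and> deg G u < deg G z" for x y z
    by auto
  then show ?thesis
    unfolding typical_def by (simp only:) blast
qed

lemma card_pverts_adj_graph: "card (pverts (adj_graph xss)) = length xss"
  by (simp add: adj_graph_def)

lemma pverts_adj_graph: "pverts (adj_graph xss) = {..<length xss}"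
  by (simp add: adj_graph_def)

lemma nbhd_adj_graph: "u < length xss \<Longrightarrow> nbhd (adj_graph xss) u = set (xss ! u)"
  by (simp add: adj_graph_def nbhd_def)

context
  fixes xss :: "nat list list"
  assumes ok: "adj_ok xss"
begin

lemma adj_okD:
  assumes "u < length xss"
  shows "distinct (xss ! u)"
    and "v \<in> set (xss ! u) \<Longrightarrow> v < length xss"
    and "v \<in> set (xss ! u) \<Longrightarrow> v \<noteq> u"
    and "v \<in> set (xss ! u) \<Longrightarrow> u \<in> set (xss ! v)"
proof -
  have "u \<in> set [0..<length xss]" using assms by simp
  then show "distinct (xss ! u)"
    and "v \<in> set (xss ! u) \<Longrightarrow> v < length xss"
    and "v \<in> set (xss ! u) \<Longrightarrow> v \<noteq> u"
    and "v \<in> set (xss ! u) \<Longrightarrow> u \<in> set (xss ! v)"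
    using ok unfolding adj_ok_def list_all_iff by blast+
qed

lemma deg_adj_graph: "u < length xss \<Longrightarrow> deg (adj_graph xss) u = adj_deg xss u"
  by (simp add: deg_def nbhd_adj_graph adj_deg_def distinct_card adj_okD(1))

lemma pair_graph_adj_graph: "pair_graph (adj_graph xss)"
  unfolding pair_graph_iff
proof (intro conjI)
  show "parcs (adj_graph xss) \<subseteq> pverts (adj_graph xss) \<times> pverts (adj_graph xss)"
    using adj_okD(2) by (auto simp: adj_graph_def)
  show "sym (parcs (adj_graph xss))"
    unfolding sym_def adj_graph_def using adj_okD(2,4) by simp blast
  show "irrefl (parcs (adj_graph xss))"
    unfolding irrefl_def adj_graph_def using adj_okD(3) by simp blast
qed (simp add: adj_graph_def)

lemma very_typical_adj_graph:
  "{u \<in> pverts (adj_graph xss). very_typical (adj_graph xss) u} = set (adj_very_typical xss)"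
proof -
  have "very_typical (adj_graph xss) u \<longleftrightarrow> 2 \<le> adj_deg xss u \<and>
      (\<forall>v\<in>set (xss ! u). adj_deg xss v \<noteq> adj_deg xss u) \<and>
      (\<exists>v\<in>set (xss ! u). adj_deg xss u < adj_deg xss v) \<and>
      (\<exists>v\<in>set (xss ! u). adj_deg xss v < adj_deg xss u)" if u: "u < length xss" for u
    unfolding very_typical_def nbhd_adj_graph[OF u] deg_adj_graph[OF u]
    by (simp add: deg_adj_graph adj_okD(2)[OF u] cong: ball_cong bex_cong)
  then show ?thesis
    by (auto simp: pverts_adj_graph adj_very_typical_def list_all_iff list_ex_iff)
qed

lemma typical_adj_graph:
  "{u \<in> pverts (adj_graph xss). typical (adj_graph xss) u} = set (adj_typical xss)"
proof -
  have "typical (adj_graph xss) u \<longleftrightarrow> 3 \<le> adj_deg xss u \<and>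
      (\<exists>v\<in>set (xss ! u). adj_deg xss v < adj_deg xss u) \<and>
      (\<exists>v\<in>set (xss ! u). adj_deg xss v = adj_deg xss u) \<and>
      (\<exists>v\<in>set (xss ! u). adj_deg xss u < adj_deg xss v)" if u: "u < length xss" for u
    unfolding typical_iff nbhd_adj_graph[OF u] deg_adj_graph[OF u]
    by (simp add: deg_adj_graph adj_okD(2)[OF u] cong: bex_cong)
  then show ?thesis
    by (auto simp: pverts_adj_graph adj_typical_def list_ex_iff)
qed

lemma distinct_adj_lists: "distinct (adj_very_typical xss)" "distinct (adj_typical xss)"
  by (simp_all add: adj_very_typical_def adj_typical_def)

lemma max_very_typical_adj: "length (adj_very_typical xss) \<le> max_very_typical (length xss)"
  using card_very_typical_le_max[OF pair_graph_adj_graph]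
  unfolding very_typical_adj_graph card_pverts_adj_graph
  by (simp add: distinct_card distinct_adj_lists)

lemma max_typical_adj: "length (adj_typical xss) \<le> max_typical (length xss)"
  using card_typical_le_max[OF pair_graph_adj_graph]
  unfolding typical_adj_graph card_pverts_adj_graph
  by (simp add: distinct_card distinct_adj_lists)

end

text \<open>The premise is a single closed conjunction so that one evaluation discharges everything
  about a concrete graph.\<close>

lemma max_very_typical_ge:
  assumes "adj_ok xss \<and> length xss = n \<and> length (adj_very_typical xss) = k"
  shows "k \<le> max_very_typical n"
  using max_very_typical_adj[of xss] assms by auto

lemma max_typical_ge:
  assumes "adj_ok xss \<and> length xss = n \<and> length (adj_typical xss) = k"
  shows "k \<le> max_typical n"
  using max_typical_adj[of xss] assms by auto

section \<open>Concrete graphs of small order, with vertices numbered by nondecreasing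
  degree\<close>

lemma max_very_typical_5_ge: "1 \<le> max_very_typical 5"
  by (rule max_very_typical_ge[where xss = "[[1], [0,4], [3,4], [2,4], [1,2,3]]"])
    code_simp

lemma max_very_typical_6_ge: "2 \<le> max_very_typical 6"
  by (rule max_very_typical_ge[where xss = "[[1], [0,5], [4,5], [4,5], [2,3,5], [1,2,3,4]]"])
    code_simp

lemma max_very_typical_7_ge: "4 \<le> max_very_typical 7"
  by (rule max_very_typical_ge[where xss = "[[3,6], [2,4], [1,5,6], [0,5,6], [1,5,6], [2,3,4,6], [0,2,3,4,5]]"])
    code_simp

lemma max_very_typical_8_ge: "5 \<le> max_very_typical 8"
  by (rule max_very_typical_ge[where xss = "[[2,4,7], [3,5,6], [0,5,6,7], [1,5,6,7], [0,5,6,7], [1,2,3,4,7], [1,2,3,4,7], [0,2,3,4,5,6]]"])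
    code_simp

lemma max_very_typical_9_ge: "6 \<le> max_very_typical 9"
  by (rule max_very_typical_ge[where xss = "[[1,2,3,4], [0,5,6,7,8], [0,5,6,7,8], [0,5,6,7,8], [0,5,6,7,8], [1,2,3,4,7,8], [1,2,3,4,7,8], [1,2,3,4,5,6,8], [1,2,3,4,5,6,7]]"])
    code_simp

lemma max_very_typical_10_ge: "8 \<le> max_very_typical 10"
  by (rule max_very_typical_ge[where xss = "[[1,2], [0,5,6], [0,3,4], [2,7,8,9], [2,7,8,9], [1,7,8,9], [1,7,8,9], [3,4,5,6,9], [3,4,5,6,9], [3,4,5,6,7,8]]"])
    code_simp

lemma max_typical_5_ge: "2 \<le> max_typical 5"
  by (rule max_typical_ge[where xss = "[[3,4], [2,4], [1,3,4], [0,2,4], [0,1,2,3]]"])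
    code_simp

lemma max_typical_6_ge: "3 \<le> max_typical 6"
  by (rule max_typical_ge[where xss = "[[2,5], [3,4,5], [0,3,4,5], [1,2,4,5], [1,2,3,5], [0,1,2,3,4]]"])
    code_simp

lemma max_typical_7_ge: "4 \<le> max_typical 7"
  by (rule max_typical_ge[where xss = "[[2,6], [3,4,5,6], [0,3,4,5,6], [1,2,4,5,6], [1,2,3,5,6], [1,2,3,4,6], [0,1,2,3,4,5]]"])
    code_simp

lemma max_typical_8_ge: "5 \<le> max_typical 8"
  by (rule max_typical_ge[where xss = "[[1,2,5], [0,2,4,7], [0,1,6,7], [4,5,6,7], [1,3,5,6,7], [0,3,4,6,7], [2,3,4,5,7], [1,2,3,4,5,6]]"])
    code_simp

section \<open>Adding a vertex\<close>

definition add_vertex :: "'a \<Rightarrow> 'a set \<Rightarrow> 'a pair_pre_digraph \<Rightarrow> 'a pair_pre_digraph" where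
  "add_vertex x N G = \<lparr>pverts = insert x (pverts G), parcs = parcs G \<union> {x} \<times> N \<union> N \<times> {x}\<rparr>"

lemma pverts_add_vertex [simp]: "pverts (add_vertex x N G) = insert x (pverts G)"
  by (simp add: add_vertex_def)

lemma card_add_vertex:
  "pair_graph G \<Longrightarrow> x \<notin> pverts G \<Longrightarrow> card (insert x (pverts G)) = Suc (card (pverts G))"
  by (simp add: pair_graph_iff)

lemma nbhd_subset: "pair_graph G \<Longrightarrow> nbhd G u \<subseteq> pverts G"
  by (auto simp: pair_graph_iff nbhd_def)

lemma nbhd_sym: "pair_graph G \<Longrightarrow> v \<in> nbhd G u \<longleftrightarrow> u \<in> nbhd G v"
  by (auto simp: pair_graph_iff nbhd_def dest: symD)

lemma deg_le:
  assumes "pair_graph G" "u \<in> pverts G"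
  shows "deg G u \<le> card (pverts G) - 1"
proof -
  have "nbhd G u \<subseteq> pverts G - {u}"
    using assms by (auto simp: pair_graph_iff nbhd_def irrefl_def)
  then have "deg G u \<le> card (pverts G - {u})"
    using assms(1) unfolding deg_def by (intro card_mono) (auto simp: pair_graph_iff)
  then show ?thesis using assms by (simp add: pair_graph_iff)
qed

context
  fixes G :: "'a pair_pre_digraph" and x :: 'a and N :: "'a set"
  assumes G: "pair_graph G" and x: "x \<notin> pverts G" and N: "N \<subseteq> pverts G"
begin

lemma pair_graph_add_vertex: "pair_graph (add_vertex x N G)"
  using G x N unfolding pair_graph_iff add_vertex_def sym_def irrefl_def by simp blast

lemma nbhd_add_vertex_new: "nbhd (add_vertex x N G) x = N"
  using G x N by (auto simp: add_vertex_def nbhd_def pair_graph_iff)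

lemma nbhd_add_vertex:
  "u \<in> pverts G \<Longrightarrow> nbhd (add_vertex x N G) u = (if u \<in> N then insert x (nbhd G u) else nbhd G u)"
  using x by (auto simp: add_vertex_def nbhd_def)

lemma deg_add_vertex_new: "deg (add_vertex x N G) x = card N"
  by (simp add: deg_def nbhd_add_vertex_new)

lemma deg_add_vertex:
  assumes "u \<in> pverts G"
  shows "deg (add_vertex x N G) u = (if u \<in> N then deg G u + 1 else deg G u)"
proof -
  have "finite (nbhd G u)" "x \<notin> nbhd G u"
    using G x nbhd_subset[OF G, of u] by (auto simp: pair_graph_iff intro: finite_subset)
  then show ?thesis
    using assms by (simp add: deg_def nbhd_add_vertex)
qed

end

lemma card_all_but_two:
  assumes "finite V" "\<And>u. u \<in> V \<Longrightarrow> u \<noteq> a \<Longrightarrow> u \<noteq> b \<Longrightarrow> R u"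
  shows "card V - 2 \<le> card {u \<in> V. R u}"
proof -
  have "card V - card {a, b} \<le> card (V - {a, b})"
    by (rule diff_card_le_card_Diff) simp
  also have "\<dots> \<le> card {u \<in> V. R u}"
    using assms by (intro card_mono) auto
  moreover have "card {a, b} \<le> 2" by (simp add: card_insert_if)
  ultimately show ?thesis by linarith
qed

section \<open>Graphs with all but two vertices very typical\<close>

text \<open>The gap of two above the degree of \<open>m\<close> is what allows hanging a leaf on \<open>m\<close>.\<close>

definition extendable :: "'a pair_pre_digraph \<Rightarrow> 'a \<Rightarrow> 'a \<Rightarrow> bool" where
  "extendable G m M \<longleftrightarrow> pair_graph G \<and> m \<in> pverts G \<and> M \<in> pverts G \<and>
     (\<forall>u\<in>pverts G. u \<noteq> m \<longrightarrow> u \<noteq> M \<longrightarrow> very_typical G u) \<and>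
     1 \<le> deg G m \<and> (\<forall>v\<in>nbhd G m. deg G m + 1 < deg G v) \<and>
     1 \<le> deg G M \<and> (\<forall>v\<in>nbhd G M. deg G v < deg G M) \<and> deg G M < card (pverts G) - 1"

lemma nbhd_nonempty: "1 \<le> deg G u \<Longrightarrow> nbhd G u \<noteq> {}"
  by (auto simp: deg_def)

locale fresh_extension =
  fixes G :: "'a pair_pre_digraph" and m M x :: 'a
  assumes ext: "extendable G m M" and x: "x \<notin> pverts G"
begin

abbreviation "V \<equiv> pverts G"
abbreviation "U \<equiv> add_vertex x V G"

lemma G: "pair_graph G" and m: "m \<in> V" and M: "M \<in> V"
  and vt: "u \<in> V \<Longrightarrow> u \<noteq> m \<Longrightarrow> u \<noteq> M \<Longrightarrow> very_typical G u"
  and deg_m: "1 \<le> deg G m" and nbhd_m: "v \<in> nbhd G m \<Longrightarrow> deg G m + 1 < deg G v"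
  and deg_M: "1 \<le> deg G M" and nbhd_M: "v \<in> nbhd G M \<Longrightarrow> deg G v < deg G M"
  and deg_M_less: "deg G M < card V - 1"
  using ext by (auto simp: extendable_def)

lemmas U_facts = pair_graph_add_vertex[OF G x order_refl] card_add_vertex[OF G x]
  nbhd_add_vertex_new[OF G x order_refl] nbhd_add_vertex[OF G x order_refl]
  deg_add_vertex_new[OF G x order_refl] deg_add_vertex[OF G x order_refl]

lemma nbhd_V: "v \<in> nbhd G u \<Longrightarrow> v \<in> V"
  using nbhd_subset[OF G] by blast

lemma deg_m_less: "deg G m + 2 < card V"
proof -
  obtain v where v: "v \<in> nbhd G m" using nbhd_nonempty[OF deg_m] by blast
  show ?thesis
    using nbhd_m[OF v] deg_le[OF G nbhd_V[OF v]] by linarith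
qed

text \<open>Ensures that the new universal vertex lies strictly above the raised degree of
  \<open>u\<close>. For \<open>u = M\<close> this is assumed; any other \<open>u\<close> is very
  typical and has a neighbour of larger degree, itself at most \<open>card V - 1\<close>.\<close>

lemma deg_less_pred:
  assumes "u \<in> V" "u \<noteq> m"
  shows "deg G u + 1 < card V"
proof (cases "u = M")
  case False
  then obtain v where v: "v \<in> nbhd G u" "deg G u < deg G v"
    using vt[OF assms] by (auto simp: very_typical_def)
  show ?thesis using v(2) deg_le[OF G nbhd_V[OF v(1)]] by linarith
qed (use deg_M_less in simp)

text \<open>Old degrees all rise by one, so comparisons among old vertices persist. The new vertex
  \<open>x\<close> gives \<open>M\<close> the higher neighbour it lacked, leaving only
  \<open>m\<close> and \<open>x\<close> as possible exceptions.\<close>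

lemma very_typical_universal:
  assumes u: "u \<in> V" "u \<noteq> m"
  shows "very_typical U u"
proof -
  have nb: "nbhd U u = insert x (nbhd G u)" and du: "deg U u = deg G u + 1" and dx: "deg U x = card V"
    using u by (simp_all add: U_facts)
  have dv: "deg U v = deg G v + 1" if "v \<in> nbhd G u" for v
    using nbhd_V[OF that] by (simp add: U_facts)
  have less: "deg G u + 1 < card V" by (rule deg_less_pred[OF u])
  have "1 \<le> deg G u \<and> (\<forall>v\<in>nbhd G u. deg G v \<noteq> deg G u) \<and> (\<exists>y\<in>nbhd G u. deg G y < deg G u)"
  proof (cases "u = M")
    case True
    then show ?thesis using deg_M nbhd_M nbhd_nonempty[OF deg_M] by fastforce
  next
    case False
    then show ?thesis using vt[OF u] by (auto simp: very_typical_def)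
  qed
  then show ?thesis
    unfolding very_typical_def nb du using less by (auto simp: dv dx)
qed

text \<open>The leaf \<open>y\<close> is a lower neighbour for \<open>m\<close>, which rises by two
  in total and stays below its old neighbours because of the gap. The leaf becomes the new minimum
  and \<open>x\<close>, not adjacent to \<open>y\<close>, the new maximum; as \<open>m\<close> now
  has degree at least 3, the gap above the leaf is restored.\<close>

lemma extendable_universal_pendant:
  assumes y: "y \<notin> pverts U"
  shows "extendable (add_vertex y {m} U) y x"
proof -
  let ?W = "add_vertex y {m} U"
  have mU: "{m} \<subseteq> pverts U" using m by simp
  note W = pair_graph_add_vertex[OF U_facts(1) y mU] card_add_vertex[OF U_facts(1) y]
    nbhd_add_vertex_new[OF U_facts(1) y mU] nbhd_add_vertex[OF U_facts(1) y mU]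
    deg_add_vertex_new[OF U_facts(1) y mU] deg_add_vertex[OF U_facts(1) y mU]
  have neq: "m \<noteq> x" "m \<noteq> y" "x \<noteq> y" using m x y by auto
  have dx: "deg ?W x = card V" using neq by (simp add: W U_facts)
  have dm: "deg ?W m = deg G m + 2" using m by (simp add: W U_facts)
  have dy: "deg ?W y = 1" by (simp add: W)
  have dW: "deg ?W u = deg G u + 1" if "u \<in> V" "u \<noteq> m" for u
    using that by (simp add: W U_facts)
  have nx: "nbhd ?W x = V" using neq by (simp add: W U_facts)
  have nm: "nbhd ?W m = insert y (insert x (nbhd G m))" using m by (simp add: W U_facts)
  have ny: "nbhd ?W y = {m}" by (simp add: W)
  have nm_deg: "deg ?W v = deg G v + 1" if v: "v \<in> nbhd G m" for v
    using nbhd_V[OF v] nbhd_m[OF v] by (intro dW) auto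
  have vt_m: "very_typical ?W m"
    unfolding very_typical_def nm using nm_deg nbhd_m deg_m_less by (fastforce simp: dm dx dy)
  have vt_u: "very_typical ?W u" if u: "u \<in> V" "u \<noteq> m" for u
  proof -
    have U: "very_typical U u" by (rule very_typical_universal[OF u])
    have nb: "nbhd ?W u = nbhd U u" and du: "deg ?W u = deg U u" using u by (simp_all add: W)
    have dv: "deg ?W v = deg U v" if "v \<in> nbhd U u" "v \<noteq> m" for v
      using that nbhd_subset[OF U_facts(1), of u] by (subst W(6)) auto
    \<comment> \<open>Hanging the leaf changes no old degree except that of \<open>m\<close>; it
      suffices that \<open>m\<close> is below \<open>u\<close> both before and after.\<close>
    have gap: "deg ?W m < deg U u \<and> deg U m < deg U u" if "m \<in> nbhd U u"
    proof -
      have "m \<in> nbhd G u" using that u neq by (simp add: U_facts)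
      then have "u \<in> nbhd G m" using nbhd_sym[OF G] by metis
      then show ?thesis using nbhd_m u m by (fastforce simp: dm U_facts)
    qed
    have "deg ?W v \<noteq> deg U u" if "v \<in> nbhd U u" for v
      using that U gap dv[OF that] by (cases "v = m") (auto simp: very_typical_def)
    moreover have "\<exists>v\<in>nbhd U u. deg U u < deg ?W v"
    proof -
      obtain v where v: "v \<in> nbhd U u" "deg U u < deg U v" using U by (auto simp: very_typical_def)
      then have "v \<noteq> m" using gap by auto
      then show ?thesis using v dv by metis
    qed
    moreover have "\<exists>v\<in>nbhd U u. deg ?W v < deg U u"
    proof -
      obtain v where v: "v \<in> nbhd U u" "deg U v < deg U u" using U by (auto simp: very_typical_def)
      then show ?thesis using gap dv by metis
    qed
    ultimately show ?thesis
      using U unfolding very_typical_def nb du by blast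
  qed
  show ?thesis
    unfolding extendable_def
  proof (intro conjI ballI impI)
    show "pair_graph ?W" by (rule W)
    show "very_typical ?W u" if "u \<in> pverts ?W" "u \<noteq> y" "u \<noteq> x" for u
      using that vt_m vt_u by auto
    show "deg ?W y + 1 < deg ?W v" if "v \<in> nbhd ?W y" for v
      using that deg_m by (auto simp: ny dm dy)
    show "deg ?W v < deg ?W x" if "v \<in> nbhd ?W x" for v
      using that deg_m_less deg_less_pred by (cases "v = m") (auto simp: nx dx dm dW)
    show "1 \<le> deg ?W y" "1 \<le> deg ?W x" using deg_m_less by (simp_all add: dx dy)
    show "deg ?W x < card (pverts ?W) - 1"
      using W(2) U_facts(2) by (simp add: dx)
  qed simp_all
qed

end

lemma fresh_vertex:
  fixes G :: "nat pair_pre_digraph"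
  assumes "pair_graph G"
  obtains x where "x \<notin> pverts G"
  using assms ex_new_if_finite[OF infinite_UNIV_nat] by (auto simp: pair_graph_iff)

lemma extendable_adj_graph:
  assumes "adj_ok xss \<and> m < length xss \<and> M < length xss \<and>
    list_all (\<lambda>u. u = m \<or> u = M \<or> u \<in> set (adj_very_typical xss)) [0..<length xss] \<and>
    1 \<le> adj_deg xss m \<and> list_all (\<lambda>v. adj_deg xss m + 1 < adj_deg xss v) (xss ! m) \<and>
    1 \<le> adj_deg xss M \<and> list_all (\<lambda>v. adj_deg xss v < adj_deg xss M) (xss ! M) \<and>
    adj_deg xss M < length xss - 1"
  shows "extendable (adj_graph xss) m M"
proof -
  have ok: "adj_ok xss" and m: "m < length xss" and M: "M < length xss" using assms by auto
  have "very_typical (adj_graph xss) u" if "u < length xss" "u \<noteq> m" "u \<noteq> M" for u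
  proof -
    have "u \<in> set (adj_very_typical xss)" using assms that by (auto simp: list_all_iff)
    then show ?thesis using very_typical_adj_graph[OF ok] by blast
  qed
  then show ?thesis
    using assms adj_okD(2)[OF ok m] adj_okD(2)[OF ok M]
    by (simp add: extendable_def pair_graph_adj_graph pverts_adj_graph nbhd_adj_graph
        deg_adj_graph[OF ok] list_all_iff)
qed

lemma extendable_11: "\<exists>G :: nat pair_pre_digraph. \<exists>m M. extendable G m M \<and> card (pverts G) = 11"
proof -
  \<comment> \<open>The graph of order 10 from above with a vertex 10 joined to everything but 0.
    Leaving out 0 opens the required gap: 0 keeps degree 2 while its neighbours rise to degree
    4.\<close>
  let ?xss = "[[1,2], [0,5,6,10], [0,3,4,10], [2,7,8,9,10], [2,7,8,9,10], [1,7,8,9,10], [1,7,8,9,10], [3,4,5,6,9,10], [3,4,5,6,9,10], [3,4,5,6,7,8,10], [1,2,3,4,5,6,7,8,9]]"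
  have "extendable (adj_graph ?xss) 0 10"
    by (rule extendable_adj_graph) code_simp
  moreover have "card (pverts (adj_graph ?xss)) = 11" by (simp add: card_pverts_adj_graph)
  ultimately show ?thesis by blast
qed

lemma extendable_odd: "\<exists>G :: nat pair_pre_digraph. \<exists>m M. extendable G m M \<and> card (pverts G) = 11 + 2 * k"
proof (induction k)
  case 0
  show ?case using extendable_11 by simp
next
  case (Suc k)
  then obtain G :: "nat pair_pre_digraph" and m M
    where G: "extendable G m M" "card (pverts G) = 11 + 2 * k" by blast
  then have pg: "pair_graph G" by (simp add: extendable_def)
  obtain x where x: "x \<notin> pverts G" using fresh_vertex[OF pg] .
  have pgU: "pair_graph (add_vertex x (pverts G) G)"
    by (rule pair_graph_add_vertex[OF pg x order_refl])
  obtain y where y: "y \<notin> pverts (add_vertex x (pverts G) G)" using fresh_vertex[OF pgU] .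
  show ?case
    using fresh_extension.extendable_universal_pendant[OF fresh_extension.intro[OF G(1) x] y] card_add_vertex[OF pg x] card_add_vertex[OF pgU y] G(2)
    by (intro exI conjI) (assumption, simp)
qed

text \<open>Odd orders come from the extendable chain, which grows by two vertices at a time. An
  even order takes one more universal vertex; the chain cannot continue from there, since a maximum
  vertex must not be universal.\<close>

lemma max_very_typical_ge_11:
  assumes "11 \<le> n"
  shows "n - 2 \<le> max_very_typical n"
proof (cases "odd n")
  case True
  then have "n = 11 + 2 * ((n - 11) div 2)" using assms by presburger
  then obtain G :: "nat pair_pre_digraph" and m M where G: "extendable G m M" "card (pverts G) = n"
    using extendable_odd by metis
  then have pg: "pair_graph G" by (simp add: extendable_def)
  have "n - 2 \<le> card {u \<in> pverts G. very_typical G u}"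
    using card_all_but_two[of "pverts G" m M "very_typical G"] G pg
    by (auto simp: extendable_def pair_graph_iff)
  then show ?thesis using card_very_typical_le_max[OF pg] G(2) by simp
next
  case False
  then have "n = Suc (11 + 2 * ((n - 12) div 2))" using assms by presburger
  then obtain G :: "nat pair_pre_digraph" and m M where G: "extendable G m M" "Suc (card (pverts G)) = n"
    using extendable_odd by metis
  then have pg: "pair_graph G" by (simp add: extendable_def)
  obtain x where x: "x \<notin> pverts G" using fresh_vertex[OF pg] .
  let ?U = "add_vertex x (pverts G) G"
  have pgU: "pair_graph ?U" by (rule pair_graph_add_vertex[OF pg x order_refl])
  have cU: "card (pverts ?U) = n" using card_add_vertex[OF pg x] G(2) by simp
  have "n - 2 \<le> card {u \<in> pverts ?U. very_typical ?U u}"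
    using card_all_but_two[of "pverts ?U" m x "very_typical ?U"] pgU cU fresh_extension.very_typical_universal[OF fresh_extension.intro[OF G(1) x]]
    by (auto simp: pair_graph_iff)
  then show ?thesis using card_very_typical_le_max[OF pgU] cU by simp
qed

section \<open>Graphs with all but two vertices typical\<close>

text \<open>\<open>M\<close> is universal and \<open>w\<close> misses only \<open>m\<close>. A new
  vertex joined to all but \<open>m\<close> then ties with the raised \<open>w\<close> and stays
  below \<open>M\<close>, so it is prepared to be typical.\<close>

definition extendable_typical :: "'a pair_pre_digraph \<Rightarrow> 'a \<Rightarrow> 'a \<Rightarrow> 'a \<Rightarrow> bool" where
  "extendable_typical G m M w \<longleftrightarrow> pair_graph G \<and> m \<in> pverts G \<and> M \<in> pverts G \<and> w \<in> pverts G \<and>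
     (\<forall>u\<in>pverts G. u \<noteq> m \<longrightarrow> u \<noteq> M \<longrightarrow> typical G u) \<and>
     deg G M = card (pverts G) - 1 \<and> deg G w = card (pverts G) - 2 \<and>
     w \<noteq> M \<and> m \<notin> nbhd G w \<and> (\<forall>u\<in>pverts G. u \<noteq> m \<longrightarrow> deg G m < deg G u)"

text \<open>Only \<open>m\<close> keeps its degree while the other old vertices rise by one. Being
  the strict minimum, \<open>m\<close> can serve only as a lower neighbour, and it remains one. The
  new vertex takes over the role of \<open>w\<close>.\<close>

lemma extendable_typical_step:
  assumes ext: "extendable_typical G m M w" and wm: "w \<noteq> m" "M \<noteq> m" and x: "x \<notin> pverts G"
  shows "extendable_typical (add_vertex x (pverts G - {m}) G) m M x"
proof -
  let ?V = "pverts G" and ?X = "add_vertex x (pverts G - {m}) G"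
  have G: "pair_graph G" and mV: "m \<in> ?V" and MV: "M \<in> ?V" and wV: "w \<in> ?V"
    and ty: "\<And>u. u \<in> ?V \<Longrightarrow> u \<noteq> m \<Longrightarrow> u \<noteq> M \<Longrightarrow> typical G u"
    and dM: "deg G M = card ?V - 1" and dw: "deg G w = card ?V - 2"
    and wM: "w \<noteq> M" and mw: "m \<notin> nbhd G w" and min: "\<And>u. u \<in> ?V \<Longrightarrow> u \<noteq> m \<Longrightarrow> deg G m < deg G u"
    using ext by (auto simp: extendable_typical_def)
  have sub: "?V - {m} \<subseteq> ?V" by auto
  note X = pair_graph_add_vertex[OF G x sub] card_add_vertex[OF G x]
    nbhd_add_vertex_new[OF G x sub] nbhd_add_vertex[OF G x sub]
    deg_add_vertex_new[OF G x sub] deg_add_vertex[OF G x sub]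
  have w_typ: "typical G w" using ty wV wm wM by blast
  \<comment> \<open>The typical vertex \<open>w\<close> has degree at least 3, which equals the
    order minus 2; this keeps the truncated subtractions below exact.\<close>
  have n: "5 \<le> card ?V" using w_typ dw by (auto simp: typical_iff)
  have fin: "finite ?V" using G by (simp add: pair_graph_iff)
  have dx: "deg ?X x = card ?V - 1" using mV fin by (simp add: X)
  have dX: "deg ?X u = deg G u + 1" if "u \<in> ?V" "u \<noteq> m" for u using that by (simp add: X)
  have dm: "deg ?X m = deg G m" using mV by (simp add: X)
  have nx: "nbhd ?X x = ?V - {m}" by (simp add: X)
  have ty_x: "typical ?X x"
  proof -
    \<comment> \<open>A lower neighbour of \<open>w\<close> also serves \<open>x\<close>: it is not
      \<open>m\<close>, hence adjacent to \<open>x\<close>, and it rises together with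
      \<open>w\<close>.\<close>
    obtain v where v: "v \<in> nbhd G w" "deg G v < deg G w" using w_typ by (auto simp: typical_iff)
    then have v': "v \<in> ?V" "v \<noteq> m" using nbhd_subset[OF G] mw by blast+
    have "deg ?X v < deg ?X x" using v(2) dw by (simp add: dX[OF v'] dx)
    moreover have "deg ?X w = deg ?X x" using dw n by (simp add: dX[OF wV wm(1)] dx)
    moreover have "deg ?X x < deg ?X M" using dM n by (simp add: dX[OF MV wm(2)] dx)
    ultimately show ?thesis
      unfolding typical_iff nx using n v' wV MV wm by (auto simp: dx)
  qed
  have ty_u: "typical ?X u" if u: "u \<in> ?V" "u \<noteq> m" "u \<noteq> M" for u
  proof -
    obtain a b c where abc: "3 \<le> deg G u" "a \<in> nbhd G u" "deg G a < deg G u"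
      "b \<in> nbhd G u" "deg G b = deg G u" "c \<in> nbhd G u" "deg G u < deg G c"
      using ty[OF u] by (auto simp: typical_iff)
    then have V: "a \<in> ?V" "b \<in> ?V" "c \<in> ?V" using nbhd_subset[OF G] by blast+
    have "b \<noteq> m" "c \<noteq> m" using min[OF u(1,2)] abc(5,7) by auto
    then have "deg ?X b = deg ?X u" "deg ?X u < deg ?X c"
      using abc V u by (simp_all add: dX)
    moreover have "deg ?X a < deg ?X u"
      using abc V u by (cases "a = m") (simp_all add: dX dm)
    ultimately show ?thesis
      unfolding typical_iff using abc u by (auto simp: X(4) dX)
  qed
  show ?thesis
    unfolding extendable_typical_def
  proof (intro conjI ballI impI)
    show "pair_graph ?X" by (rule X)
    show "typical ?X u" if "u \<in> pverts ?X" "u \<noteq> m" "u \<noteq> M" for u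
      using that ty_x ty_u by auto
    show "deg ?X M = card (pverts ?X) - 1" "deg ?X x = card (pverts ?X) - 2"
      using X(2) n dM by (simp_all add: dx dX[OF MV wm(2)])
    show "deg ?X m < deg ?X u" if "u \<in> pverts ?X" "u \<noteq> m" for u
      using that min[OF wV wm(1)] dw min by (fastforce simp: dm dx dX)
    show "x \<noteq> M" using x MV by auto
    show "m \<notin> nbhd ?X x" by (simp add: nx)
  qed (use mV MV in simp_all)
qed

lemma extendable_typical_adj_graph:
  assumes "adj_ok xss \<and> m < length xss \<and> M < length xss \<and> w < length xss \<and>
    list_all (\<lambda>u. u = m \<or> u = M \<or> u \<in> set (adj_typical xss)) [0..<length xss] \<and>
    adj_deg xss M = length xss - 1 \<and> adj_deg xss w = length xss - 2 \<and>
    w \<noteq> M \<and> m \<notin> set (xss ! w) \<and>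
    list_all (\<lambda>u. u = m \<or> adj_deg xss m < adj_deg xss u) [0..<length xss]"
  shows "extendable_typical (adj_graph xss) m M w"
proof -
  have ok: "adj_ok xss" using assms by auto
  have "typical (adj_graph xss) u" if "u < length xss" "u \<noteq> m" "u \<noteq> M" for u
  proof -
    have "u \<in> set (adj_typical xss)" using assms that by (auto simp: list_all_iff)
    then show ?thesis using typical_adj_graph[OF ok] by blast
  qed
  then show ?thesis
    using assms
    by (auto simp add: extendable_typical_def pair_graph_adj_graph pverts_adj_graph
        card_pverts_adj_graph nbhd_adj_graph deg_adj_graph[OF ok] list_all_iff)
qed

lemma extendable_typical_9:
  "\<exists>G :: nat pair_pre_digraph. \<exists>m M w. extendable_typical G m M w \<and> w \<noteq> m \<and> M \<noteq> m \<and> card (pverts G) = 9"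
proof -
  \<comment> \<open>The degrees are 5, 6, 6, 6, 6, 7, 7, 7, 8: vertex 0 is the strict minimum, 8 is
    universal, and 7 misses only 0.\<close>
  let ?xss = "[[1,2,3,4,8], [0,4,5,6,7,8], [0,3,5,6,7,8], [0,2,5,6,7,8], [0,1,5,6,7,8], [1,2,3,4,6,7,8], [1,2,3,4,5,7,8], [1,2,3,4,5,6,8], [0,1,2,3,4,5,6,7]]"
  have "extendable_typical (adj_graph ?xss) 0 8 7"
    by (rule extendable_typical_adj_graph) code_simp
  moreover have "card (pverts (adj_graph ?xss)) = 9" by (simp add: card_pverts_adj_graph)
  moreover have "(7::nat) \<noteq> 0" "(8::nat) \<noteq> 0" by simp_all
  ultimately show ?thesis by blast
qed

lemma extendable_typical_ex:
  assumes "9 \<le> n"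
  shows "\<exists>G :: nat pair_pre_digraph. \<exists>m M w. extendable_typical G m M w \<and> w \<noteq> m \<and> M \<noteq> m \<and> card (pverts G) = n"
  using assms
proof (induction n rule: nat_induct_at_least)
  case base
  show ?case by (rule extendable_typical_9)
next
  case (Suc n)
  then obtain G :: "nat pair_pre_digraph" and m M w
    where G: "extendable_typical G m M w" "w \<noteq> m" "M \<noteq> m" "card (pverts G) = n" by blast
  then have pg: "pair_graph G" and m: "m \<in> pverts G" by (simp_all add: extendable_typical_def)
  obtain x where x: "x \<notin> pverts G" using fresh_vertex[OF pg] .
  then have "x \<noteq> m" using m by auto
  moreover have "card (pverts (add_vertex x (pverts G - {m}) G)) = Suc n"
    using card_add_vertex[OF pg x] G(4) by simp
  ultimately show ?case using extendable_typical_step[OF G(1-3) x] G(3) by blast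
qed

lemma max_typical_ge_9:
  assumes "9 \<le> n"
  shows "n - 2 \<le> max_typical n"
proof -
  obtain G :: "nat pair_pre_digraph" and m M w where G: "extendable_typical G m M w" "card (pverts G) = n"
    using extendable_typical_ex[OF assms] by blast
  then have pg: "pair_graph G" by (simp add: extendable_typical_def)
  have "n - 2 \<le> card {u \<in> pverts G. typical G u}"
    using card_all_but_two[of "pverts G" m M "typical G"] G pg
    by (auto simp: extendable_typical_def pair_graph_iff)
  then show ?thesis using card_typical_le_max[OF pg] G(2) by simp
qed

section \<open>Small orders\<close>

lemma max_very_typical_less:
  assumes "\<not> feasible False n 0 (int k) (int (n - k)) 0 0 (int n * (int n - 1))"
  shows "max_very_typical n < k"
proof -
  have "card {u \<in> pverts G. very_typical G u} < k"
    if G: "pair_graph G" "card (pverts G) = n" for G :: "nat pair_pre_digraph"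
  proof (rule ccontr)
    assume "\<not> card {u \<in> pverts G. very_typical G u} < k"
    \<comment> \<open>The search refutes exactly \<open>k\<close> marks, so a larger set is first
      cut down to size \<open>k\<close>.\<close>
    then obtain A where A: "A \<subseteq> {u \<in> pverts G. very_typical G u}" "card A = k"
      using obtain_subset_with_card_n[of k] by (metis not_less)
    interpret typical_set G A False
      by (rule typical_set.intro) (use G(1) A(1) in \<open>auto simp: very_typical_def\<close>)
    show False using feasible_degrees assms A(2) G(2) by simp
  qed
  then show ?thesis
    unfolding max_very_typical_def using max_candidates[of very_typical n]
    by (auto simp: Max_less_iff)
qed

lemma max_typical_less:
  assumes "\<not> feasible True n 0 (int k) (int (n - k)) 0 0 (int n * (int n - 1))"
  shows "max_typical n < k"
proof -
  have "card {u \<in> pverts G. typical G u} < k"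
    if G: "pair_graph G" "card (pverts G) = n" for G :: "nat pair_pre_digraph"
  proof (rule ccontr)
    assume "\<not> card {u \<in> pverts G. typical G u} < k"
    then obtain A where A: "A \<subseteq> {u \<in> pverts G. typical G u}" "card A = k"
      using obtain_subset_with_card_n[of k] by (metis not_less)
    interpret typical_set G A True
      by (rule typical_set.intro) (use G(1) A(1) in \<open>auto simp: typical_iff\<close>)
    show False using feasible_degrees assms A(2) G(2) by simp
  qed
  then show ?thesis
    unfolding max_typical_def using max_candidates[of typical n]
    by (auto simp: Max_less_iff)
qed

text \<open>The refuted number of marks is always one more than the claimed maximum, so these bounds
  meet the lower bounds given by the concrete graphs.\<close>

lemma max_very_typical_small:
  "max_very_typical 1 < 1" "max_very_typical 2 < 1" "max_very_typical 3 < 1" "max_very_typical 4 < 1"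
  "max_very_typical 5 < 2" "max_very_typical 6 < 3" "max_very_typical 7 < 5" "max_very_typical 8 < 6"
  "max_very_typical 9 < 7"
  by (rule max_very_typical_less, code_simp)+

lemma max_typical_small:
  "max_typical 1 < 1" "max_typical 2 < 1" "max_typical 3 < 1" "max_typical 4 < 1"
  "max_typical 5 < 3" "max_typical 6 < 4" "max_typical 7 < 5" "max_typical 8 < 6"
  by (rule max_typical_less, code_simp)+

text \<open>Vertices \<open>a\<close> of minimum and \<open>b\<close> of maximum degree violate
  \<open>R\<close>. If some vertex satisfies \<open>R\<close>, its strictly lower neighbour shows
  that degrees are not constant, so \<open>a\<close> and \<open>b\<close> are two different
  exceptions.\<close>

lemma card_le_order_minus_2:
  assumes G: "pair_graph G"
    and lower: "\<And>v. v \<in> pverts G \<Longrightarrow> R v \<Longrightarrow> \<exists>w\<in>nbhd G v. deg G w < deg G v"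
    and higher: "\<And>v. v \<in> pverts G \<Longrightarrow> R v \<Longrightarrow> \<exists>w\<in>nbhd G v. deg G v < deg G w"
  shows "card {v \<in> pverts G. R v} \<le> card (pverts G) - 2"
proof (cases "{v \<in> pverts G. R v} = {}")
  case True
  then show ?thesis by (metis card.empty zero_le)
next
  case False
  then obtain v where v: "v \<in> pverts G" "R v" by auto
  have fin: "finite (pverts G)" using G by (simp add: pair_graph_iff)
  have img: "finite (deg G ` pverts G)" "deg G ` pverts G \<noteq> {}" using fin v by auto
  obtain a where a: "a \<in> pverts G" "deg G a = Min (deg G ` pverts G)" using Min_in[OF img] by auto
  obtain b where b: "b \<in> pverts G" "deg G b = Max (deg G ` pverts G)" using Max_in[OF img] by auto
  have min: "deg G a \<le> deg G u" and max: "deg G u \<le> deg G b" if "u \<in> pverts G" for u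
    using that fin by (simp_all add: a(2) b(2))
  have "\<not> R a"
    using lower[OF a(1)] min nbhd_subset[OF G, of a] by (meson leD subsetD)
  moreover have "\<not> R b"
    using higher[OF b(1)] max nbhd_subset[OF G, of b] by (meson leD subsetD)
  ultimately have sub: "{v \<in> pverts G. R v} \<subseteq> pverts G - {a, b}" by auto
  obtain w where "w \<in> nbhd G v" "deg G w < deg G v" using lower[OF v] by blast
  then have "deg G a < deg G b"
    using min[of w] max[OF v(1)] nbhd_subset[OF G, of v] by fastforce
  then have "a \<noteq> b" by auto
  then have "card (pverts G - {a, b}) = card (pverts G) - 2"
    using a b by (simp add: card_Diff_subset)
  then show ?thesis using card_mono[OF _ sub] fin by simp
qed

lemma max_very_typical_le: "max_very_typical n \<le> n - 2"
proof -
  have "card {u \<in> pverts G. very_typical G u} \<le> n - 2"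
    if "pair_graph G" "card (pverts G) = n" for G :: "nat pair_pre_digraph"
    using card_le_order_minus_2[OF that(1), of "very_typical G"] that(2)
    by (auto simp: very_typical_def)
  then show ?thesis
    unfolding max_very_typical_def using max_candidates[of very_typical n] by auto
qed

lemma max_typical_le: "max_typical n \<le> n - 2"
proof -
  have "card {u \<in> pverts G. typical G u} \<le> n - 2"
    if "pair_graph G" "card (pverts G) = n" for G :: "nat pair_pre_digraph"
    using card_le_order_minus_2[OF that(1), of "typical G"] that(2)
    by (auto simp: typical_iff)
  then show ?thesis
    unfolding max_typical_def using max_candidates[of typical n] by auto
qed

theorem theorem1:
  fixes n :: nat
  assumes "n \<ge> 1"
  shows "max_very_typical n =
           (if n \<le> 4 then 0
            else if n \<le> 6 then n - 4
            else if n \<le> 9 then n - 3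
            else n - 2) \<and>
         max_typical n =
           (if n \<le> 4 then 0
            else if n \<le> 8 then n - 3
            else n - 2)"
proof -
  have cases: "n = 1 \<or> n = 2 \<or> n = 3 \<or> n = 4 \<or> n = 5 \<or> n = 6 \<or> n = 7 \<or> n = 8 \<or> n = 9 \<or> n = 10 \<or> 11 \<le> n"
    using assms by presburger
  have very_large: "max_very_typical n = n - 2" if "10 \<le> n"
    using that max_very_typical_ge_11[of n] max_very_typical_10_ge max_very_typical_le[of n]
    by (cases "n = 10") auto
  have typ_large: "max_typical n = n - 2" if "9 \<le> n"
    using that max_typical_ge_9[of n] max_typical_le[of n] by simp
  show ?thesis
  proof (cases "n \<le> 9")
    case True
    have "max_very_typical n =
        (if n \<le> 4 then 0 else if n \<le> 6 then n - 4 else if n \<le> 9 then n - 3 else n - 2)"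
      using cases True max_very_typical_small max_very_typical_5_ge max_very_typical_6_ge
        max_very_typical_7_ge max_very_typical_8_ge max_very_typical_9_ge
      by (elim disjE) auto
    \<comment> \<open>Order 9 already has the value \<open>n - 2\<close> here, which is why
      \<open>typ_large\<close> is among the facts.\<close>
    moreover have "max_typical n = (if n \<le> 4 then 0 else if n \<le> 8 then n - 3 else n - 2)"
      using cases True max_typical_small max_typical_5_ge max_typical_6_ge
        max_typical_7_ge max_typical_8_ge typ_large
      by (elim disjE) auto
    ultimately show ?thesis ..
  qed (simp add: very_large typ_large)
qed

end
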